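(* Let $A\in\mathbb{C}^{n\times n}$. Then $A$ is convergent with the optimal convergence rate (i.e. $A$ is convergent and its optimal convergence rate exists), which is $\gamma(A)$, if and only if one of the following holds: (i) $\rho(A)<1$ and all $\lambda\in\sigma(A)$ satisfying $|\lambda|=\gamma(A)$ are semisimple. (ii) $\rho(A)=1$, $\lambda=1$ is the only eigenvalue of $A$ on the unit circle, $\lambda=1$ is semisimple, and all $\lambda\in\sigma(A)$ satisfying $|\lambda|=\gamma(A)$ are semisimple.
   Context: $\|\cdot\|$ is the operator norm on matrices induced by the Euclidean norm; $\mathbb{N}=\{1,2,3,\dots\}$; $\sigma(A)$ is the set of all eigenvalues of $A$ and $\rho(A)=\max\{|\lambda|:\lambda\in\sigma(A)\}$ is the spectral radius. A matrix $A\in\mathbb{C}^{n\times n}$ is convergent (to $A^\infty\in\mathbb{C}^{n\times n}$) if $\|A^k-A^\infty\|\to 0$ as $k\to\infty$ for some $A^\infty$. It is linearly convergent to $A^\infty$ with rate $\mu\in[0,1)$ if there are $M,N>0$ such that $\|A^k-A^\infty\|\le M\mu^k$ for all $k\in\mathbb{N}$ with $k>N$; then $\mu$ is called a convergence rate of $A$. If the infimum of all convergence rates of $A$ is itself a convergence rate, this minimum is called the optimal convergence rate of $A$. Define $\gamma(A):=\max\{|\lambda| : \lambda\in(\{0\}\cup\sigma(A))\setminus\{1\}\}$. For $\lambda\in\sigma(A)$, $\mathrm{index}(\lambda)$ is the smallest positive integer $k$ with $\mathrm{rank}\,(A-\lambda \mathrm{Id})^k=\mathrm{rank}\,(A-\lambda\mathrm{Id})^{k+1}$,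 and $\lambda$ is semisimple if $\mathrm{index}(\lambda)=1$.
   Formalization: The formal theorem also assumes that if 0 is an eigenvalue of A and γ(A)=0 then 0 is semisimple; without this the claim fails, e.g. A=[[0,1],[0,0]] has optimal rate 0=γ(A) but its eigenvalue 0 is not semisimple. *)

theory Defs
  imports
    Complex_Main
    "HOL-Analysis.L2_Norm"
    "Jordan_Normal_Form.Spectral_Radius"
    "Jordan_Normal_Form.DL_Rank"
begin

text \<open>
  Complex \<open>n \<times> n\<close> matrices are elements of \<^term>\<open>carrier_mat n n\<close>. The set of eigenvalues is
  \<^const>\<open>spectrum\<close>, the spectral radius is \<^const>\<open>spectral_radius\<close>, and
  \<^term>\<open>char_matrix A l\<close> is the matrix \<open>A - l Id\<close>.
\<close>

definition euclid_norm :: "complex vec \<Rightarrow> real" where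
  "euclid_norm v = L2_set (\<lambda>i. cmod (v $ i)) {..<dim_vec v}"

text \<open>The quotient is \<open>0\<close> at \<open>v = 0\<close>, so the zero vector need not be excluded.\<close>

definition op_norm :: "complex mat \<Rightarrow> real" where
  "op_norm A = (SUP v \<in> carrier_vec (dim_col A). euclid_norm (A *\<^sub>v v) / euclid_norm v)"

definition convergent_to :: "complex mat \<Rightarrow> complex mat \<Rightarrow> bool" where
  "convergent_to A L \<longleftrightarrow> L \<in> carrier_mat (dim_row A) (dim_col A) \<and>
     (\<lambda>k. op_norm (A ^\<^sub>m k - L)) \<longlonglongrightarrow> 0"

definition convergent_mat :: "complex mat \<Rightarrow> bool" where
  "convergent_mat A \<longleftrightarrow> (\<exists>L. convergent_to A L)"

text \<open>
  The rate \<open>\<mu> = 0\<close> is allowed; it means that the powers of \<open>A\<close> are eventually constant. In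
  particular every nilpotent matrix has optimal convergence rate \<open>0\<close>, even when its eigenvalue
  \<open>0\<close> is not semisimple. Thus the characterization of optimality by semisimple eigenvalues fails for
  such matrices, so the theorem excludes a non-semisimple eigenvalue \<open>0\<close> when
  \<open>gamma A = 0\<close>.
\<close>

definition linearly_convergent_to :: "complex mat \<Rightarrow> complex mat \<Rightarrow> real \<Rightarrow> bool" where
  "linearly_convergent_to A L \<mu> \<longleftrightarrow> L \<in> carrier_mat (dim_row A) (dim_col A) \<and>
     0 \<le> \<mu> \<and> \<mu> < 1 \<and>
     (\<exists>M N :: real. M > 0 \<and> N > 0 \<and>
        (\<forall>k :: nat. real k > N \<longrightarrow> op_norm (A ^\<^sub>m k - L) \<le> M * \<mu> ^ k))"

definition convergence_rate :: "complex mat \<Rightarrow> real \<Rightarrow> bool" where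
  "convergence_rate A \<mu> \<longleftrightarrow> (\<exists>L. linearly_convergent_to A L \<mu>)"

definition optimal_convergence_rate :: "complex mat \<Rightarrow> real \<Rightarrow> bool" where
  "optimal_convergence_rate A \<mu> \<longleftrightarrow>
     convergence_rate A \<mu> \<and> \<mu> = Inf {\<nu>. convergence_rate A \<nu>}"

definition gamma :: "complex mat \<Rightarrow> real" where
  "gamma A = Max (cmod ` (({0} \<union> spectrum A) - {1}))"

definition eigen_index :: "complex mat \<Rightarrow> complex \<Rightarrow> nat" where
  "eigen_index A l = (LEAST k. 0 < k \<and>
     vec_space.rank (dim_row A) (char_matrix A l ^\<^sub>m k) =
     vec_space.rank (dim_row A) (char_matrix A l ^\<^sub>m (k + 1)))"

definition semisimple :: "complex mat \<Rightarrow> complex \<Rightarrow> bool" where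
  "semisimple A l \<longleftrightarrow> eigen_index A l = 1"

end

theory Submission
  imports Defs "Jordan_Normal_Form.Jordan_Normal_Form_Uniqueness"
begin

text \<open>
  Everything is decided by the Jordan blocks of \<open>A\<close>: the powers of a block of size \<open>m\<close> with
  eigenvalue \<open>l\<close> behave like \<open>l\<^sup>k\<close> times a polynomial in \<open>k\<close> of degree \<open>m - 1\<close>, and \<open>l\<close> is
  semisimple if and only if all of its blocks have size one (\<open>semisimple_iff_jordan_blocks\<close>).

  Suppose (i) or (ii). Then the blocks of the eigenvalue \<open>1\<close>, if there are any, have size one and
  are constant under powers, the blocks with \<open>|l| = gamma A\<close> have size one and decay exactly
  like \<open>(gamma A)\<^sup>k\<close>, and for \<open>|l| < gamma A\<close> the gap absorbs the polynomial. Hence the powers of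
  \<open>A\<close> converge at rate \<open>gamma A\<close> (\<open>jordan_nf_pow_limit\<close>, \<open>convergence_rate_gamma\<close>). No smaller
  rate is possible, because along an eigenvector for \<open>l \<noteq> 1\<close> the increments \<open>A\<^sup>k\<^sup>+\<^sup>1 v - A\<^sup>k v\<close> are
  of order \<open>|l|\<^sup>k\<close> (\<open>eigenvalue_le_convergence_rate\<close>).

  Conversely, let \<open>gamma A\<close> be a rate. Rates are below \<open>1\<close>, so every eigenvalue other than \<open>1\<close> lies
  in the open unit disc, and whether \<open>1\<close> is an eigenvalue decides between (i) and (ii).
  A non-semisimple eigenvalue has a Jordan chain of length two, along which the increments carry an
  extra factor growing linearly in \<open>k\<close>, or are constant if the eigenvalue is \<open>1\<close>. Neither is
  compatible with the rate if the eigenvalue is \<open>1\<close> or has modulus \<open>gamma A > 0\<close>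
  (\<open>semisimple_of_convergence_rate\<close>). If \<open>gamma A = 0\<close>, the only eigenvalue to consider is \<open>0\<close>,
  which is semisimple by hypothesis.
\<close>

section \<open>Semisimple eigenvalues\<close>

text \<open>
  Rank-nullity for the linear map \<open>v \<mapsto> A v\<close>, whose image is the column space. It translates the
  ranks in \<^const>\<open>eigen_index\<close> into kernels, which carry the Jordan chains.
\<close>

lemma rank_nullity_mat:
  fixes A :: "'a :: field mat"
  assumes A: "A \<in> carrier_mat nr nc"
  shows "vec_space.rank nr A + kernel_dim A = nc"
proof -
  let ?V = "module_vec TYPE('a) nc" and ?W = "module_vec TYPE('a) nr"
  have "(*\<^sub>v) A \<in> LinearCombinations.module_hom class_ring ?V ?W"
    unfolding LinearCombinations.module_hom_def
    using A by (simp add: module_vec_simps mult_add_distrib_mat_vec[OF A] mult_mat_vec[OF A])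
  then have hom: "mod_hom class_ring ?V ?W ((*\<^sub>v) A)"
    using vec_module by (intro mod_hom.intro mod_hom_axioms.intro)
  then have lin: "linear_map class_ring ?V ?W ((*\<^sub>v) A)"
    using vec_vs by (intro linear_map.intro)
  have im: "mod_hom.im ?V ((*\<^sub>v) A) = vec_space.col_space nr A"
    using A unfolding mod_hom.im_def[OF hom] vec_space.col_space_eq[OF A] by (auto simp: module_vec_simps)
  have ker: "mod_hom.ker ?V ?W ((*\<^sub>v) A) = mat_kernel A"
    unfolding mod_hom.ker_def[OF hom] mat_kernel[OF A] by (simp add: module_vec_simps)
  show ?thesis
    using linear_map.rank_nullity[OF lin vec_space.fin_dim] A
    unfolding im ker vec_space.dim_is_n vec_space.rank_def vec_space.col_space_def kernel_dim_def
    by simp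
qed

lemma rank_char_matrix_pow:
  assumes A: "A \<in> carrier_mat n n"
  shows "vec_space.rank n (char_matrix A l ^\<^sub>m k) + dim_gen_eigenspace A l k = n"
  unfolding dim_gen_eigenspace_def
  by (rule rank_nullity_mat) (use A in auto)

text \<open>
  For block sizes \<open>ms\<close>, the left-hand sum is the dimension of the \<open>k\<close>-th generalized eigenspace;
  it stops growing exactly when \<open>k\<close> reaches the largest block.
\<close>

lemma sum_list_min_Suc_eq_iff:
  fixes ms :: "nat list"
  shows "sum_list (map (min k) ms) = sum_list (map (min (Suc k)) ms) \<longleftrightarrow> (\<forall>m\<in>set ms. m \<le> k)"
proof (induction ms)
  case (Cons m ms)
  have "sum_list (map (min k) ms) \<le> sum_list (map (min (Suc k)) ms)"
    by (rule sum_list_mono) simp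
  moreover have "min k m \<le> min (Suc k) m" "min k m = min (Suc k) m \<longleftrightarrow> m \<le> k" by auto
  ultimately have "sum_list (map (min k) (m # ms)) = sum_list (map (min (Suc k)) (m # ms)) \<longleftrightarrow>
      m \<le> k \<and> sum_list (map (min k) ms) = sum_list (map (min (Suc k)) ms)"
    unfolding list.map sum_list.Cons by linarith
  then show ?case using Cons by simp
qed simp

text \<open>
  The index of an eigenvalue is the size of its largest Jordan block, because the rank of
  \<open>(A - l Id)\<^sup>k\<close> is \<open>n\<close> minus the sum of \<open>min k m\<close> over the sizes \<open>m\<close> of the blocks of \<open>l\<close>.
\<close>

lemma semisimple_iff_jordan_blocks:
  assumes A: "A \<in> carrier_mat n n" and J: "jordan_nf A n_as"
  shows "semisimple A l \<longleftrightarrow> (\<forall>m. (m, l) \<in> set n_as \<longrightarrow> m \<le> 1)"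
proof -
  define ms where "ms = map fst [(m, a)\<leftarrow>n_as. a = l]"
  have ms: "set ms = {m. (m, l) \<in> set n_as}" unfolding ms_def by force
  have "vec_space.rank n (char_matrix A l ^\<^sub>m k) = vec_space.rank n (char_matrix A l ^\<^sub>m (k + 1))
      \<longleftrightarrow> (\<forall>m\<in>set ms. m \<le> k)" for k
    using rank_char_matrix_pow[OF A, of l k] rank_char_matrix_pow[OF A, of l "k + 1"]
      sum_list_min_Suc_eq_iff[of k ms]
    unfolding dim_gen_eigenspace[OF J] ms_def[symmetric] by auto
  then have idx: "eigen_index A l = (LEAST k. 0 < k \<and> (\<forall>m\<in>set ms. m \<le> k))"
    using A unfolding eigen_index_def by simp
  \<comment> \<open>A \<open>LEAST\<close> is meaningful only if a witness exists; any bound on the block sizes is one.\<close>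
  have "0 < Suc (sum_list ms) \<and> (\<forall>m\<in>set ms. m \<le> Suc (sum_list ms))"
    using member_le_sum_list[of _ ms] by (auto intro: le_SucI)
  then have "0 < eigen_index A l \<and> (\<forall>m\<in>set ms. m \<le> eigen_index A l)"
    unfolding idx by (rule LeastI)
  then have "semisimple A l \<Longrightarrow> \<forall>m\<in>set ms. m \<le> 1"
    unfolding semisimple_def by metis
  moreover have "semisimple A l" if "\<forall>m\<in>set ms. m \<le> 1"
    unfolding semisimple_def idx using that by (intro Least_equality) auto
  ultimately show ?thesis using ms by auto
qed

text \<open>
  If the ranks of \<open>B = A - l Id\<close> and \<open>B\<^sup>2\<close> differ, so do their kernels. A vector \<open>w\<close> that only
  \<open>B\<^sup>2\<close> kills starts a Jordan chain of length two, continued by \<open>v = B w\<close>.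
\<close>

lemma not_semisimple_obtains_chain:
  assumes A: "A \<in> carrier_mat n n" and "\<not> semisimple A l"
  obtains v w where "v \<in> carrier_vec n" "w \<in> carrier_vec n" "v \<noteq> 0\<^sub>v n"
    "A *\<^sub>v v = l \<cdot>\<^sub>v v" "A *\<^sub>v w = l \<cdot>\<^sub>v w + v"
proof -
  define B where "B = char_matrix A l"
  have B: "B \<in> carrier_mat n n" using A unfolding B_def by simp
  have "vec_space.rank n (B ^\<^sub>m 1) \<noteq> vec_space.rank n (B ^\<^sub>m (1 + 1))"
  proof
    assume "vec_space.rank n (B ^\<^sub>m 1) = vec_space.rank n (B ^\<^sub>m (1 + 1))"
    then have "semisimple A l" using A
      unfolding semisimple_def eigen_index_def B_def by (intro Least_equality) auto
    with assms show False by simp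
  qed
  then have "kernel_dim B \<noteq> kernel_dim (B * B)"
    using rank_nullity_mat[OF B] rank_nullity_mat[of "B * B" n n] B by auto
  then have "mat_kernel B \<noteq> mat_kernel (B * B)"
    using B unfolding kernel_dim_def by auto
  with mat_kernel_mult_subset[OF B B]
  obtain w where w: "w \<in> mat_kernel (B * B)" "w \<notin> mat_kernel B" by auto
  have wc: "w \<in> carrier_vec n" and z: "B *\<^sub>v (B *\<^sub>v w) = 0\<^sub>v n"
    using mat_kernelD[of "B * B" n n w] w B by auto
  have nz: "B *\<^sub>v w \<noteq> 0\<^sub>v n" using w mat_kernelI[OF B wc] by auto
  have Bu: "A *\<^sub>v u = l \<cdot>\<^sub>v u + B *\<^sub>v u" if "u \<in> carrier_vec n" for u
  proof -
    have "B *\<^sub>v u = A *\<^sub>v u + - l \<cdot>\<^sub>v u"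
      unfolding B_def char_matrix_def using A that
      by (intro eq_vecI) (auto simp: add_scalar_prod_distrib[of _ n])
    then show ?thesis using A that by (intro eq_vecI) auto
  qed
  show thesis
    by (rule that[of "B *\<^sub>v w" w]) (use B wc nz z Bu[OF wc] Bu[of "B *\<^sub>v w"] in auto)
qed

text \<open>
  The factor \<open>k + 1\<close> in front of \<open>l\<^sup>k\<close> is what rules out the rate \<open>|l|\<close> when \<open>l\<close> is not
  semisimple, and convergence when moreover \<open>l = 1\<close>.
\<close>

lemma mat_pow_mult_chain:
  fixes A :: "'a :: field mat"
  assumes A: "A \<in> carrier_mat n n" and v: "eigenvector A v l" and w: "w \<in> carrier_vec n"
    and Aw: "A *\<^sub>v w = l \<cdot>\<^sub>v w + v"
  shows "A ^\<^sub>m Suc k *\<^sub>v w = l ^ Suc k \<cdot>\<^sub>v w + (of_nat (Suc k) * l ^ k) \<cdot>\<^sub>v v"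
proof (induction k)
  case 0
  show ?case using A v Aw unfolding eigenvector_def by simp
next
  case (Suc k)
  have vc: "v \<in> carrier_vec n" using v A unfolding eigenvector_def by simp
  have P: "A ^\<^sub>m Suc k \<in> carrier_mat n n" using A by (rule pow_carrier_mat)
  have "A ^\<^sub>m Suc (Suc k) *\<^sub>v w = A ^\<^sub>m Suc k *\<^sub>v (l \<cdot>\<^sub>v w + v)"
    unfolding pow_mat.simps(2)[of A "Suc k"] Aw[symmetric] by (rule assoc_mult_mat_vec[OF P A w])
  also have "\<dots> = l \<cdot>\<^sub>v (A ^\<^sub>m Suc k *\<^sub>v w) + A ^\<^sub>m Suc k *\<^sub>v v"
    using vc w mult_add_distrib_mat_vec[OF P, of "l \<cdot>\<^sub>v w" v] mult_mat_vec[OF P w, of l] by simp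
  also have "\<dots> = l ^ Suc (Suc k) \<cdot>\<^sub>v w + (of_nat (Suc (Suc k)) * l ^ Suc k) \<cdot>\<^sub>v v"
    unfolding Suc eigenvector_pow[OF A v] using vc w by (intro eq_vecI) (auto simp: algebra_simps)
  finally show ?case .
qed

section \<open>The operator norm and matrix entries\<close>

lemma norm_bound_exists:
  obtains b where "norm_bound X b" "0 \<le> b"
proof
  show "norm_bound X \<bar>Max {norm (X $$ (i,j)) | i j. i < dim_row X \<and> j < dim_col X}\<bar>"
    using norm_bound_max[of X] unfolding norm_bound_def by (meson abs_ge_self order_trans)
qed simp

lemma cmod_le_euclid_norm: "i < dim_vec v \<Longrightarrow> cmod (v $ i) \<le> euclid_norm v"
  unfolding euclid_norm_def by (rule member_le_L2_set) auto

lemma euclid_norm_nonneg: "0 \<le> euclid_norm v"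
  unfolding euclid_norm_def by (rule L2_set_nonneg)

text \<open>
  A crude constant suffices here: rates are insensitive to constant factors, so entrywise bounds
  and bounds on \<^const>\<open>op_norm\<close> may be exchanged freely.
\<close>

lemma euclid_norm_mult_mat_vec_le:
  assumes X: "X \<in> carrier_mat nr nc" and b: "norm_bound X b" and v: "v \<in> carrier_vec nc"
  shows "euclid_norm (X *\<^sub>v v) \<le> real nr * real nc * b * euclid_norm v"
proof -
  have entry: "cmod ((X *\<^sub>v v) $ i) \<le> real nc * b * euclid_norm v" if i: "i < nr" for i
  proof -
    have "cmod ((X *\<^sub>v v) $ i) = cmod (\<Sum>j<nc. X $$ (i, j) * v $ j)"
      using X v i by (simp add: scalar_prod_def atLeast0LessThan)
    also have "\<dots> \<le> (\<Sum>j<nc. b * euclid_norm v)"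
    proof (rule sum_norm_le)
      fix j assume "j \<in> {..<nc}"
      then show "cmod (X $$ (i, j) * v $ j) \<le> b * euclid_norm v"
        using b X v i cmod_le_euclid_norm[of j v] unfolding norm_bound_def norm_mult
        by (intro mult_mono') auto
    qed
    finally show ?thesis by simp
  qed
  have "euclid_norm (X *\<^sub>v v) \<le> (\<Sum>i<nr. cmod ((X *\<^sub>v v) $ i))"
    using X L2_set_le_sum[of "{..<nr}" "\<lambda>i. cmod ((X *\<^sub>v v) $ i)"]
    unfolding euclid_norm_def by (simp del: index_mult_mat_vec)
  also have "\<dots> \<le> (\<Sum>i<nr. real nc * b * euclid_norm v)"
    by (rule sum_mono) (simp add: entry)
  finally show ?thesis by simp
qed

lemma op_norm_le:
  assumes X: "X \<in> carrier_mat nr nc" and b: "norm_bound X b" "0 \<le> b"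
  shows "op_norm X \<le> real nr * real nc * b"
  unfolding op_norm_def
proof (rule cSUP_least)
  fix v :: "complex vec" assume v: "v \<in> carrier_vec (dim_col X)"
  show "euclid_norm (X *\<^sub>v v) / euclid_norm v \<le> real nr * real nc * b"
  proof (cases "euclid_norm v = 0")
    case False
    then have "0 < euclid_norm v" using euclid_norm_nonneg[of v] by simp
    then show ?thesis using euclid_norm_mult_mat_vec_le[OF X b(1), of v] v X
      by (simp add: divide_le_eq)
  qed (use b in simp)
qed (use zero_carrier_vec in blast)

text \<open>
  The supremum in \<^const>\<open>op_norm\<close> is over reals, so it dominates its members only because the
  quotients are bounded above, here by means of a bound on the entries.
\<close>

lemma euclid_norm_mult_mat_vec_le_op_norm:
  assumes v: "v \<in> carrier_vec (dim_col X)"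
  shows "euclid_norm (X *\<^sub>v v) \<le> op_norm X * euclid_norm v"
proof -
  have X: "X \<in> carrier_mat (dim_row X) (dim_col X)" by simp
  obtain b where b: "norm_bound X b" "0 \<le> b" by (rule norm_bound_exists)
  have "euclid_norm (X *\<^sub>v v) / euclid_norm v \<le> op_norm X" unfolding op_norm_def
  proof (rule cSUP_upper[OF v], rule bdd_aboveI2)
    fix u :: "complex vec" assume u: "u \<in> carrier_vec (dim_col X)"
    show "euclid_norm (X *\<^sub>v u) / euclid_norm u \<le> real (dim_row X) * real (dim_col X) * b"
    proof (cases "euclid_norm u = 0")
      case False
      then have "0 < euclid_norm u" using euclid_norm_nonneg[of u] by simp
      then show ?thesis using euclid_norm_mult_mat_vec_le[OF X b(1) u] by (simp add: divide_le_eq)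
    qed (use b in simp)
  qed
  moreover have "euclid_norm (X *\<^sub>v v) \<le> 0" if "euclid_norm v = 0"
    using euclid_norm_mult_mat_vec_le[OF X b(1) v] that by simp
  ultimately show ?thesis using euclid_norm_nonneg[of v]
    by (cases "euclid_norm v = 0") (auto simp: divide_le_eq)
qed

text \<open>
  The quotient at a unit vector is a nonnegative member of the supremum. Without columns there is
  no unit vector, but then the only quotient is the one at the empty vector, which is \<open>0\<close>.
\<close>

lemma op_norm_nonneg: "0 \<le> op_norm X"
proof (cases "dim_col X = 0")
  case True
  then have "carrier_vec (dim_col X) = {0\<^sub>v 0 :: complex vec}" by auto
  then show ?thesis unfolding op_norm_def by (simp add: euclid_norm_def)
next
  case False
  then have "0 < cmod (unit_vec (dim_col X) 0 $ 0)" by simp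
  also have "\<dots> \<le> euclid_norm (unit_vec (dim_col X) 0)"
    using False by (intro cmod_le_euclid_norm) simp
  finally have "0 < euclid_norm (unit_vec (dim_col X) 0)" .
  moreover have "0 \<le> op_norm X * euclid_norm (unit_vec (dim_col X) 0)"
    using euclid_norm_mult_mat_vec_le_op_norm[of "unit_vec (dim_col X) 0" X]
      euclid_norm_nonneg[of "X *\<^sub>v unit_vec (dim_col X) 0"] by simp
  ultimately show ?thesis by (simp add: zero_le_mult_iff)
qed

section \<open>Geometric convergence of powers of Jordan matrices\<close>

text \<open>
  The entries are polynomial in \<open>k\<close> times \<open>|a|\<^sup>k\<close>, and the strict gap between \<open>|a|\<close> and \<open>g\<close>
  absorbs the polynomial. The intermediate radius \<open>c\<close> is positive even for \<open>a = 0\<close>, so the powers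
  with shifted exponents can be compared with \<open>c\<^sup>k\<close>.
\<close>

lemma jordan_block_pow_norm_bound:
  fixes a :: complex
  assumes a: "cmod a < g" and g: "g \<le> 1"
  obtains M where "\<And>k. norm_bound (jordan_block m a ^\<^sub>m k) (M * g ^ k)"
proof -
  define c where "c = (cmod a + g) / 2"
  have "0 < g" using a norm_ge_zero[of a] by (rule le_less_trans[rotated])
  then have ac: "cmod a \<le> c" and c0: "0 < c" and cg: "c < g"
    using a add_nonneg_pos[OF norm_ge_zero[of a]] unfolding c_def by simp_all
  have "0 < c / g" "c / g < 1" using c0 cg by auto
  from poly_exp_max_constant_bound[OF this, of "1 / c ^ m" "m - 1"]
  obtain M where M: "\<And>k. 1 / c ^ m * (c / g) ^ k * max 1 (real k ^ (m - 1)) \<le> M" by auto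
  have "norm_bound (jordan_block m a ^\<^sub>m k) (M * g ^ k)" for k
  proof (rule norm_boundI)
    fix i j assume "i < dim_row (jordan_block m a ^\<^sub>m k)" "j < dim_col (jordan_block m a ^\<^sub>m k)"
    then have i: "i < m" and j: "j < m" by (simp_all only: jordan_block_pow_dim)
    have "cmod a ^ (k + i - j) \<le> c ^ (k + i - j)" using ac by (intro power_mono) auto
    \<comment> \<open>The exponent is at least \<open>k - m\<close>, and \<open>c < 1\<close> makes the smaller exponent the worse one.\<close>
    also have "c ^ (k + i - j) \<le> c ^ k / c ^ m"
    proof -
      have "c ^ (k + i - j) * c ^ m = c ^ (k + i - j + m)" by (simp add: power_add)
      also have "\<dots> \<le> c ^ k" using c0 cg g j by (intro power_decreasing) auto
      finally show ?thesis using c0 by (simp add: pos_le_divide_eq)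
    qed
    finally have "cmod a ^ (k + i - j) * max 1 (real k ^ (m - 1)) \<le> c ^ k / c ^ m * max 1 (real k ^ (m - 1))"
      by (rule mult_right_mono) simp
    also have "\<dots> = 1 / c ^ m * (c / g) ^ k * max 1 (real k ^ (m - 1)) * g ^ k"
      using c0 cg by (simp add: power_divide)
    also have "\<dots> \<le> M * g ^ k" using M[of k] c0 cg by (intro mult_right_mono) auto
    finally show "cmod ((jordan_block m a ^\<^sub>m k) $$ (i, j)) \<le> M * g ^ k"
      using jordan_block_bound[OF i j, of a k] by linarith
  qed
  then show thesis by (rule that)
qed

text \<open>
  A block of size one for the eigenvalue \<open>1\<close> is its own limit, and the powers of every other
  admissible block are of order \<open>g\<^sup>k\<close>: the polynomial factor is absent when the size is one, and
  absorbed when \<open>|a| < g\<close>. With \<open>0\<^sup>0 = 1\<close> this covers \<open>a = g = 0\<close> and the exponent \<open>k = 0\<close>.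
\<close>

lemma jordan_block_pow_limit:
  fixes a :: complex
  assumes g: "0 \<le> g" "g \<le> 1"
    and a: "a = 1 \<and> m \<le> 1 \<or> cmod a < g \<or> cmod a = g \<and> m \<le> 1"
  shows "\<exists>L \<in> carrier_mat m m. \<exists>M \<ge> 0. \<forall>k. norm_bound (jordan_block m a ^\<^sub>m k - L) (M * g ^ k)"
  using a
proof (elim disjE conjE)
  assume a: "a = 1" and "m \<le> 1"
  then have "jordan_block m a ^\<^sub>m k - 1\<^sub>m m = 0\<^sub>m m m" for k
    unfolding jordan_block_pow by (intro eq_matI) auto
  then show ?thesis
    by (intro bexI[of _ "1\<^sub>m m"] exI[of _ 0]) (auto simp: norm_bound_def)
next
  assume "cmod a < g"
  from jordan_block_pow_norm_bound[OF this g(2)]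
  obtain M where M: "\<And>k. norm_bound (jordan_block m a ^\<^sub>m k) (M * g ^ k)" by blast
  have "norm_bound (jordan_block m a ^\<^sub>m k - 0\<^sub>m m m) (\<bar>M\<bar> * g ^ k)" for k
    unfolding norm_bound_def
  proof (intro allI impI)
    fix i j assume "i < dim_row (jordan_block m a ^\<^sub>m k - 0\<^sub>m m m)" "j < dim_col (jordan_block m a ^\<^sub>m k - 0\<^sub>m m m)"
    then have "cmod ((jordan_block m a ^\<^sub>m k - 0\<^sub>m m m) $$ (i, j)) \<le> M * g ^ k"
      using M[of k] unfolding norm_bound_def by simp
    also have "\<dots> \<le> \<bar>M\<bar> * g ^ k" using g by (intro mult_right_mono) auto
    finally show "cmod ((jordan_block m a ^\<^sub>m k - 0\<^sub>m m m) $$ (i, j)) \<le> \<bar>M\<bar> * g ^ k" .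
  qed
  then show ?thesis by (intro bexI[of _ "0\<^sub>m m m"] exI[of _ "\<bar>M\<bar>"]) auto
next
  assume a: "cmod a = g" and "m \<le> 1"
  then have "norm_bound (jordan_block m a ^\<^sub>m k - 0\<^sub>m m m) (1 * g ^ k)" for k
    unfolding jordan_block_pow norm_bound_def by (auto simp: norm_power le_Suc_eq)
  then show ?thesis by (intro bexI[of _ "0\<^sub>m m m"] exI[of _ 1]) auto
qed

lemma jordan_matrix_pow_limit:
  fixes n_as :: "(nat \<times> complex) list"
  assumes g: "0 \<le> g" "g \<le> 1"
    and "\<And>m a. (m, a) \<in> set n_as \<Longrightarrow> a = 1 \<and> m \<le> 1 \<or> cmod a < g \<or> cmod a = g \<and> m \<le> 1"
  shows "\<exists>L \<in> carrier_mat (sum_list (map fst n_as)) (sum_list (map fst n_as)). \<exists>M \<ge> 0.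
    \<forall>k. norm_bound (jordan_matrix n_as ^\<^sub>m k - L) (M * g ^ k)"
  using assms(3)
proof (induction n_as)
  case Nil
  then show ?case
    by (intro bexI[of _ "0\<^sub>m 0 0"] exI[of _ 0]) (auto simp: norm_bound_def)
next
  case (Cons ma n_as)
  obtain m a where ma: "ma = (m, a)" by force
  define d where "d = sum_list (map fst n_as)"
  obtain L1 M1 where L1: "L1 \<in> carrier_mat m m" and M1: "0 \<le> M1"
    and B1: "\<And>k. norm_bound (jordan_block m a ^\<^sub>m k - L1) (M1 * g ^ k)"
    using jordan_block_pow_limit[OF g Cons.prems[of m a]] ma by auto
  obtain L2 M2 where L2: "L2 \<in> carrier_mat d d" and M2: "0 \<le> M2"
    and B2: "\<And>k. norm_bound (jordan_matrix n_as ^\<^sub>m k - L2) (M2 * g ^ k)"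
    using Cons.IH Cons.prems d_def by auto
  define L where "L = four_block_mat L1 (0\<^sub>m m d) (0\<^sub>m d m) L2"
  define M where "M = max M1 M2"
  have M: "0 \<le> M" "M1 \<le> M" "M2 \<le> M" using M1 unfolding M_def by auto
  have J2: "jordan_matrix n_as \<in> carrier_mat d d" unfolding d_def by simp
  have Jk: "jordan_matrix (ma # n_as) ^\<^sub>m k =
      four_block_mat (jordan_block m a ^\<^sub>m k) (0\<^sub>m m d) (0\<^sub>m d m) (jordan_matrix n_as ^\<^sub>m k)" for k
    unfolding ma jordan_matrix_Cons d_def[symmetric] using J2 by (intro pow_four_block_mat) auto
  have "norm_bound (jordan_matrix (ma # n_as) ^\<^sub>m k - L) (M * g ^ k)" for k
  proof (rule norm_boundI)
    fix i j
    assume "i < dim_row (jordan_matrix (ma # n_as) ^\<^sub>m k - L)" "j < dim_col (jordan_matrix (ma # n_as) ^\<^sub>m k - L)"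
    then have i: "i < m + d" and j: "j < m + d" using L1 L2 unfolding L_def by auto
    have Mg: "0 \<le> M * g ^ k" "M1 * g ^ k \<le> M * g ^ k" "M2 * g ^ k \<le> M * g ^ k"
      using M g by (auto intro: mult_right_mono)
    have b1: "cmod ((jordan_block m a ^\<^sub>m k) $$ (i, j) - L1 $$ (i, j)) \<le> M1 * g ^ k" if "i < m" "j < m"
      using B1[of k] L1 that unfolding norm_bound_def by auto
    have b2: "cmod ((jordan_matrix n_as ^\<^sub>m k) $$ (i - m, j - m) - L2 $$ (i - m, j - m)) \<le> M2 * g ^ k"
      if "\<not> i < m" "\<not> j < m"
      using B2[of k, unfolded norm_bound_def, rule_format, of "i - m" "j - m"] L2 J2 that i j by auto
    have "jordan_matrix n_as ^\<^sub>m k \<in> carrier_mat d d" using J2 by simp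
    then have dims: "dim_row (jordan_matrix n_as ^\<^sub>m k) = d" "dim_col (jordan_matrix n_as ^\<^sub>m k) = d"
      "dim_row L1 = m" "dim_col L1 = m" "dim_row L2 = d" "dim_col L2 = d"
      using L1 L2 by (simp_all only: carrier_matD)
    have "(jordan_matrix (ma # n_as) ^\<^sub>m k - L) $$ (i, j) =
        (if i < m then if j < m then (jordan_block m a ^\<^sub>m k) $$ (i, j) - L1 $$ (i, j) else 0
         else if j < m then 0 else (jordan_matrix n_as ^\<^sub>m k) $$ (i - m, j - m) - L2 $$ (i - m, j - m))"
      unfolding Jk L_def using i j
      by (simp add: dims index_minus_mat del: pow_mat_dim)
    then show "cmod ((jordan_matrix (ma # n_as) ^\<^sub>m k - L) $$ (i, j)) \<le> M * g ^ k"
      using order_trans[OF b1 Mg(2)] order_trans[OF b2 Mg(3)] Mg(1) by (simp split: if_splits)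
  qed
  moreover have "L \<in> carrier_mat (m + d) (m + d)" unfolding L_def using L1 L2 by simp
  moreover have "sum_list (map fst (ma # n_as)) = m + d" unfolding ma d_def by simp
  ultimately show ?case using M(1) by metis
qed

text \<open>
  Conjugation by the transformation matrices of the Jordan normal form changes only the constant.
\<close>

lemma jordan_nf_pow_limit:
  fixes A :: "complex mat"
  assumes A: "A \<in> carrier_mat n n" and J: "jordan_nf A n_as"
    and g: "0 \<le> g" "g \<le> 1"
    and blocks: "\<And>m a. (m, a) \<in> set n_as \<Longrightarrow> a = 1 \<and> m \<le> 1 \<or> cmod a < g \<or> cmod a = g \<and> m \<le> 1"
  obtains L M where "L \<in> carrier_mat n n" "0 \<le> M" "\<And>k. norm_bound (A ^\<^sub>m k - L) (M * g ^ k)"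
proof -
  define Jm where "Jm = jordan_matrix n_as"
  from J have "similar_mat A Jm" unfolding jordan_nf_def Jm_def by auto
  then obtain P Q where wit: "similar_mat_wit A Jm P Q" unfolding similar_mat_def by auto
  from similar_mat_witD2[OF A wit]
  have Jc: "Jm \<in> carrier_mat n n" and P: "P \<in> carrier_mat n n" and Q: "Q \<in> carrier_mat n n" by auto
  have dim: "sum_list (map fst n_as) = n" using carrier_matD(1)[OF Jc] unfolding Jm_def by simp
  from jordan_matrix_pow_limit[of g n_as, OF g blocks, unfolded dim, folded Jm_def]
  obtain L M where L: "L \<in> carrier_mat n n" and M: "0 \<le> M"
    and B: "\<And>k. norm_bound (Jm ^\<^sub>m k - L) (M * g ^ k)" by auto
  obtain p where p: "norm_bound P p" "0 \<le> p" by (rule norm_bound_exists)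
  obtain q where q: "norm_bound Q q" "0 \<le> q" by (rule norm_bound_exists)
  show thesis
  proof (rule that)
    show "P * L * Q \<in> carrier_mat n n" using P Q L by simp
    show "0 \<le> p * M * real n * q * real n" using p q M by simp
    fix k
    have Jk: "Jm ^\<^sub>m k \<in> carrier_mat n n" using Jc by simp
    have "A ^\<^sub>m k - P * L * Q = P * (Jm ^\<^sub>m k - L) * Q"
      unfolding similar_mat_wit_pow_id[OF wit]
      using P Q L Jk by (simp add: mult_minus_distrib_mat[of _ n n] minus_mult_distrib_mat[of _ n n])
    moreover have "norm_bound (P * (Jm ^\<^sub>m k - L) * Q) (p * (M * g ^ k) * of_nat n * q * of_nat n)"
      using P Q L Jk by (intro norm_bound_mult[of _ n n _ n] p q B) auto
    ultimately show "norm_bound (A ^\<^sub>m k - P * L * Q) (p * M * real n * q * real n * g ^ k)"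
      by (simp add: mult_ac)
  qed
qed

section \<open>What a convergence rate forces on the eigenvalues\<close>

lemma convergence_rate_nonneg_less_1: "convergence_rate A \<mu> \<Longrightarrow> 0 \<le> \<mu> \<and> \<mu> < 1"
  unfolding convergence_rate_def linearly_convergent_to_def by auto

lemma convergence_rate_eventually:
  assumes "convergence_rate A \<mu>"
  obtains L M where "L \<in> carrier_mat (dim_row A) (dim_col A)" "0 < M"
    "\<forall>\<^sub>F k in sequentially. op_norm (A ^\<^sub>m k - L) \<le> M * \<mu> ^ k"
proof -
  obtain L M N where L: "L \<in> carrier_mat (dim_row A) (dim_col A)" and M: "0 < M"
    and bound: "\<And>k. real k > N \<Longrightarrow> op_norm (A ^\<^sub>m k - L) \<le> M * \<mu> ^ k"
    using assms unfolding convergence_rate_def linearly_convergent_to_def by auto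
  have "\<forall>\<^sub>F k in sequentially. real k > N"
    by (rule eventually_at_top_linorderI[of "nat \<lceil>N\<rceil> + 1"]) linarith
  then have "\<forall>\<^sub>F k in sequentially. op_norm (A ^\<^sub>m k - L) \<le> M * \<mu> ^ k"
    by eventually_elim (rule bound)
  with L M show thesis by (rule that)
qed

text \<open>
  Differences of consecutive powers no longer contain the limit matrix, so what a rate implies for
  eigenvalues can be read off without knowing the limit.
\<close>

lemma convergence_rate_increments:
  assumes A: "A \<in> carrier_mat n n" and rate: "convergence_rate A \<mu>" and w: "w \<in> carrier_vec n"
  obtains K where "\<forall>\<^sub>F k in sequentially. \<forall>i<n. cmod ((A ^\<^sub>m Suc k *\<^sub>v w) $ i - (A ^\<^sub>m k *\<^sub>v w) $ i) \<le> K * \<mu> ^ k"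
proof -
  have \<mu>: "0 \<le> \<mu>" "\<mu> < 1" using convergence_rate_nonneg_less_1[OF rate] by auto
  obtain L M where L: "L \<in> carrier_mat n n" and M: "0 < M"
    and bound: "\<forall>\<^sub>F k in sequentially. op_norm (A ^\<^sub>m k - L) \<le> M * \<mu> ^ k"
    using convergence_rate_eventually[OF rate] A by (metis carrier_matD)
  have close: "cmod ((A ^\<^sub>m k *\<^sub>v w) $ i - (L *\<^sub>v w) $ i) \<le> M * \<mu> ^ k * euclid_norm w"
    if k: "op_norm (A ^\<^sub>m k - L) \<le> M * \<mu> ^ k" and i: "i < n" for k i
  proof -
    have P: "A ^\<^sub>m k \<in> carrier_mat n n" using A by (rule pow_carrier_mat)
    have "(A ^\<^sub>m k *\<^sub>v w) $ i - (L *\<^sub>v w) $ i = ((A ^\<^sub>m k - L) *\<^sub>v w) $ i"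
      using P L w i by (simp add: minus_mult_distrib_mat_vec[of _ n n])
    also have "cmod \<dots> \<le> euclid_norm ((A ^\<^sub>m k - L) *\<^sub>v w)"
      using P L i by (intro cmod_le_euclid_norm) simp
    also have "\<dots> \<le> op_norm (A ^\<^sub>m k - L) * euclid_norm w"
      using P L w by (intro euclid_norm_mult_mat_vec_le_op_norm) simp
    also have "\<dots> \<le> M * \<mu> ^ k * euclid_norm w"
      using k euclid_norm_nonneg by (intro mult_right_mono)
    finally show ?thesis .
  qed
  from bound have "\<forall>\<^sub>F k in sequentially. op_norm (A ^\<^sub>m Suc k - L) \<le> M * \<mu> ^ Suc k"
    by (rule eventually_sequentially_Suc[THEN iffD2])
  with bound have "\<forall>\<^sub>F k in sequentially. \<forall>i<n.
      cmod ((A ^\<^sub>m Suc k *\<^sub>v w) $ i - (A ^\<^sub>m k *\<^sub>v w) $ i) \<le> 2 * M * euclid_norm w * \<mu> ^ k"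
  proof eventually_elim
    case (elim k)
    show ?case
    proof (intro allI impI)
      fix i assume i: "i < n"
      have "cmod ((A ^\<^sub>m Suc k *\<^sub>v w) $ i - (A ^\<^sub>m k *\<^sub>v w) $ i) \<le>
          cmod ((A ^\<^sub>m Suc k *\<^sub>v w) $ i - (L *\<^sub>v w) $ i) + cmod ((A ^\<^sub>m k *\<^sub>v w) $ i - (L *\<^sub>v w) $ i)"
        using norm_triangle_ineq4[of "(A ^\<^sub>m Suc k *\<^sub>v w) $ i - (L *\<^sub>v w) $ i" "(A ^\<^sub>m k *\<^sub>v w) $ i - (L *\<^sub>v w) $ i"]
        by (simp del: index_mult_mat_vec pow_mat.simps)
      also have "\<dots> \<le> M * \<mu> ^ Suc k * euclid_norm w + M * \<mu> ^ k * euclid_norm w"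
        using elim i by (intro add_mono close)
      also have "M * \<mu> ^ Suc k * euclid_norm w \<le> M * \<mu> ^ k * euclid_norm w"
        using M \<mu> euclid_norm_nonneg by (intro mult_right_mono mult_left_mono power_decreasing) auto
      finally show "cmod ((A ^\<^sub>m Suc k *\<^sub>v w) $ i - (A ^\<^sub>m k *\<^sub>v w) $ i) \<le> 2 * M * euclid_norm w * \<mu> ^ k"
        by (simp add: mult_ac)
    qed
  qed
  then show thesis by (rule that)
qed

lemma eigenvector_nonzero_entry:
  assumes "A \<in> carrier_mat n n" "eigenvector A v l"
  obtains i where "i < n" "v $ i \<noteq> 0"
  using assms unfolding eigenvector_def by (metis carrier_matD(1) carrier_vecD eq_vecI index_zero_vec(1,2))

text \<open>
  Along an eigenvector \<open>v\<close> the increments are \<open>l\<^sup>k (l - 1) v\<close>, so they decay no faster than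
  \<open>|l|\<^sup>k\<close> as soon as \<open>l \<noteq> 1\<close>.
\<close>

lemma eigenvalue_le_convergence_rate:
  assumes A: "A \<in> carrier_mat n n" and rate: "convergence_rate A \<mu>"
    and l: "l \<in> spectrum A" "l \<noteq> 1"
  shows "cmod l \<le> \<mu>"
proof (rule ccontr)
  assume less: "\<not> cmod l \<le> \<mu>"
  obtain v where v: "eigenvector A v l" using l unfolding spectrum_def eigenvalue_def by auto
  have vc: "v \<in> carrier_vec n" using v A unfolding eigenvector_def by simp
  obtain i where i: "i < n" "v $ i \<noteq> 0" by (rule eigenvector_nonzero_entry[OF A v])
  obtain K where K: "\<forall>\<^sub>F k in sequentially. \<forall>i<n.
      cmod ((A ^\<^sub>m Suc k *\<^sub>v v) $ i - (A ^\<^sub>m k *\<^sub>v v) $ i) \<le> K * \<mu> ^ k"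
    by (rule convergence_rate_increments[OF A rate vc])
  define c where "c = cmod ((l - 1) * v $ i)"
  have c: "0 < c" using l i unfolding c_def by simp
  have \<mu>: "0 \<le> \<mu>" and l0: "0 < cmod l" using convergence_rate_nonneg_less_1[OF rate] less by auto
  have "(\<lambda>k. K * (\<mu> / cmod l) ^ k) \<longlonglongrightarrow> K * 0"
    using \<mu> l0 less by (intro tendsto_intros LIMSEQ_power_zero) (simp add: divide_less_eq)
  then have "\<forall>\<^sub>F k in sequentially. K * (\<mu> / cmod l) ^ k < c"
    using c by (intro order_tendstoD(2)) auto
  with K have "\<forall>\<^sub>F k in sequentially. False"
  proof eventually_elim
    case (elim k)
    have "(A ^\<^sub>m Suc k *\<^sub>v v) $ i - (A ^\<^sub>m k *\<^sub>v v) $ i = l ^ k * ((l - 1) * v $ i)"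
      unfolding eigenvector_pow[OF A v] using vc i by (simp add: algebra_simps)
    with elim(1) i have "cmod l ^ k * c \<le> K * \<mu> ^ k"
      by (metis c_def norm_mult norm_power)
    then have "c \<le> K * (\<mu> / cmod l) ^ k"
      using l0 by (simp add: power_divide field_simps)
    with elim(2) show False by simp
  qed
  then show False by simp
qed

text \<open>
  Along the head \<open>w\<close> of a Jordan chain of length two, each entry of the increments has
  the form \<open>l\<^sup>k (c + (k + 1) d)\<close>, where \<open>d\<close> is the entry of \<open>(l - 1) v\<close>. For \<open>l \<noteq> 1\<close> with
  \<open>|l| = \<mu>\<close> the linear factor defeats every constant multiple of \<open>\<mu>\<^sup>k\<close> where
  \<open>d \<noteq> 0\<close>. For \<open>l = 1\<close> the increments are the constant \<open>v\<close> and do not tend to \<open>0\<close>.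
  For \<open>\<mu> = 0\<close> and \<open>l = 0\<close> the argument breaks down: a nilpotent block reaches its limit after
  finitely many steps whatever its size.
\<close>

lemma semisimple_of_convergence_rate:
  assumes A: "A \<in> carrier_mat n n" and rate: "convergence_rate A \<mu>"
    and l: "l = 1 \<or> 0 < \<mu> \<and> cmod l = \<mu>"
  shows "semisimple A l"
proof (rule ccontr)
  assume "\<not> semisimple A l"
  then obtain v w where vc: "v \<in> carrier_vec n" and w: "w \<in> carrier_vec n" and "v \<noteq> 0\<^sub>v n"
    and "A *\<^sub>v v = l \<cdot>\<^sub>v v" and Aw: "A *\<^sub>v w = l \<cdot>\<^sub>v w + v"
    by (rule not_semisimple_obtains_chain[OF A])
  then have v: "eigenvector A v l" using A unfolding eigenvector_def by auto
  obtain i where i: "i < n" "v $ i \<noteq> 0" by (rule eigenvector_nonzero_entry[OF A v])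
  obtain K where K: "\<forall>\<^sub>F k in sequentially. \<forall>i<n.
      cmod ((A ^\<^sub>m Suc k *\<^sub>v w) $ i - (A ^\<^sub>m k *\<^sub>v w) $ i) \<le> K * \<mu> ^ k"
    by (rule convergence_rate_increments[OF A rate w])
  define c where "c = l * (l - 1) * w $ i + l * v $ i"
  define d where "d = (l - 1) * v $ i"
  have "\<forall>\<^sub>F k in sequentially. \<forall>i<n.
      cmod ((A ^\<^sub>m Suc (Suc k) *\<^sub>v w) $ i - (A ^\<^sub>m Suc k *\<^sub>v w) $ i) \<le> K * \<mu> ^ Suc k"
    using K by (rule eventually_sequentially_Suc[THEN iffD2])
  then have incr: "\<forall>\<^sub>F k in sequentially. cmod l ^ k * cmod (c + of_nat (Suc k) * d) \<le> K * \<mu> ^ Suc k"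
  proof eventually_elim
    case (elim k)
    have "(A ^\<^sub>m Suc (Suc k) *\<^sub>v w) $ i - (A ^\<^sub>m Suc k *\<^sub>v w) $ i = l ^ k * (c + of_nat (Suc k) * d)"
      unfolding mat_pow_mult_chain[OF A v w Aw] c_def d_def using vc w i by (simp add: algebra_simps)
    with elim i show ?case by (metis norm_mult norm_power)
  qed
  have \<mu>: "0 \<le> \<mu>" "\<mu> < 1" using convergence_rate_nonneg_less_1[OF rate] by auto
  from l show False
  proof
    assume "l = 1"
    then have cd: "c = v $ i" "d = 0" unfolding c_def d_def by auto
    have "(\<lambda>k. K * \<mu> ^ Suc k) \<longlonglongrightarrow> K * 0"
      using \<mu> by (intro tendsto_intros LIMSEQ_Suc LIMSEQ_power_zero) simp
    then have "\<forall>\<^sub>F k in sequentially. K * \<mu> ^ Suc k < cmod (v $ i)"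
      using i by (intro order_tendstoD(2)) auto
    with incr have "\<forall>\<^sub>F k in sequentially. False"
      by eventually_elim (use \<open>l = 1\<close> cd in auto)
    then show False by simp
  next
    assume l: "0 < \<mu> \<and> cmod l = \<mu>"
    then have d: "0 < cmod d" using \<mu> i unfolding d_def by auto
    obtain N where N: "\<And>k. N \<le> k \<Longrightarrow> cmod l ^ k * cmod (c + of_nat (Suc k) * d) \<le> K * \<mu> ^ Suc k"
      using incr unfolding eventually_sequentially by auto
    obtain m where m: "K * \<mu> + cmod c < of_nat m * cmod d"
      using ex_less_of_nat_mult[OF d] by blast
    \<comment> \<open>Large enough for the eventual bound to hold and for the linear term to beat it.\<close>
    define k where "k = max N m"
    have "\<mu> ^ k * cmod (c + of_nat (Suc k) * d) \<le> \<mu> ^ k * (K * \<mu>)"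
      using N[of k] l unfolding k_def by (simp add: mult_ac)
    then have "cmod (c + of_nat (Suc k) * d) \<le> K * \<mu>"
      using l by simp
    moreover have "cmod (of_nat (Suc k) * d) \<le> cmod (c + of_nat (Suc k) * d) + cmod c"
      using norm_triangle_ineq4[of "c + of_nat (Suc k) * d" c] by simp
    moreover have "of_nat m * cmod d \<le> cmod (of_nat (Suc k) * d)"
      unfolding norm_mult norm_of_nat k_def by (intro mult_right_mono) auto
    ultimately show False using m by simp
  qed
qed

section \<open>The rate \<open>gamma A\<close>\<close>

lemma finite_gamma_set:
  assumes "A \<in> carrier_mat n n"
  shows "finite (cmod ` (({0} \<union> spectrum A) - {1}))"
  using card_finite_spectrum(1)[OF assms] by simp

lemma cmod_le_gamma:
  assumes "A \<in> carrier_mat n n" "l \<in> spectrum A" "l \<noteq> 1"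
  shows "cmod l \<le> gamma A"
  unfolding gamma_def using assms by (intro Max_ge finite_gamma_set) auto

lemma gamma_attained:
  assumes "A \<in> carrier_mat n n"
  obtains l where "l = 0 \<or> l \<in> spectrum A" "l \<noteq> 1" "gamma A = cmod l"
proof -
  have "gamma A \<in> cmod ` (({0} \<union> spectrum A) - {1})"
    unfolding gamma_def by (intro Max_in finite_gamma_set[OF assms]) force
  then show thesis using that by auto
qed

lemma jordan_block_eigenvalue:
  fixes A :: "'a :: field mat"
  assumes A: "A \<in> carrier_mat n n" and J: "jordan_nf A n_as" and ma: "(m, a) \<in> set n_as"
  shows "a \<in> spectrum A"
proof -
  have "m \<noteq> 0" using J ma unfolding jordan_nf_def by force
  then have "Polynomial.order a (char_poly A) \<noteq> 0"
    using jordan_nf_block_size_order_bound[OF J ma] by simp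
  then have "poly (char_poly A) a = 0" by (rule order_root[THEN iffD2, OF disjI2])
  then show ?thesis unfolding spectrum_root_char_poly[OF A] by simp
qed

text \<open>
  The hypotheses make every Jordan block admissible for \<open>jordan_nf_pow_limit\<close> with \<open>g = gamma A\<close>.
\<close>

lemma convergence_rate_gamma:
  assumes A: "A \<in> carrier_mat n n" and lt: "gamma A < 1"
    and one: "1 \<in> spectrum A \<Longrightarrow> semisimple A 1"
    and max: "\<And>l. l \<in> spectrum A \<Longrightarrow> cmod l = gamma A \<Longrightarrow> semisimple A l"
  shows "convergence_rate A (gamma A)"
proof -
  obtain n_as where J: "jordan_nf A n_as"
    using jordan_nf_exists[OF A] char_poly_factorized[OF A] by blast
  have g: "0 \<le> gamma A" using gamma_attained[OF A] norm_ge_zero by metis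
  have blocks: "a = 1 \<and> m \<le> 1 \<or> cmod a < gamma A \<or> cmod a = gamma A \<and> m \<le> 1"
    if ma: "(m, a) \<in> set n_as" for m a
  proof -
    have a: "a \<in> spectrum A" by (rule jordan_block_eigenvalue[OF A J ma])
    have size: "m \<le> 1" if "semisimple A a"
      using that ma unfolding semisimple_iff_jordan_blocks[OF A J] by blast
    show ?thesis
    proof (cases "a = 1")
      case True
      then show ?thesis using a one size by blast
    next
      case False
      then have "cmod a \<le> gamma A" by (rule cmod_le_gamma[OF A a])
      then show ?thesis using max[OF a] size by (auto simp: le_less)
    qed
  qed
  obtain L M where L: "L \<in> carrier_mat n n" and M: "0 \<le> M"
    and B: "\<And>k. norm_bound (A ^\<^sub>m k - L) (M * gamma A ^ k)"
    using jordan_nf_pow_limit[OF A J g less_imp_le[OF lt] blocks] by blast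
  \<comment> \<open>The summand \<open>1\<close> makes the constant positive, as the definition of a rate demands.\<close>
  have "op_norm (A ^\<^sub>m k - L) \<le> (real n * real n * M + 1) * gamma A ^ k" for k
  proof -
    have "op_norm (A ^\<^sub>m k - L) \<le> real n * real n * (M * gamma A ^ k)"
      using L M g by (intro op_norm_le[OF _ B]) auto
    also have "\<dots> \<le> (real n * real n * M + 1) * gamma A ^ k"
      using g by (simp add: algebra_simps)
    finally show ?thesis .
  qed
  moreover have "0 < real n * real n * M + 1" using M by (simp add: add_nonneg_pos)
  ultimately have "\<exists>M N :: real. 0 < M \<and> 0 < N \<and>
      (\<forall>k :: nat. N < real k \<longrightarrow> op_norm (A ^\<^sub>m k - L) \<le> M * gamma A ^ k)"
    by (intro exI[of _ "real n * real n * M + 1"] exI[of _ "1 :: real"]) simp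
  then have "linearly_convergent_to A L (gamma A)"
    unfolding linearly_convergent_to_def using A L g lt by simp
  then show ?thesis unfolding convergence_rate_def by blast
qed

lemma convergence_rate_imp_convergent:
  assumes "convergence_rate A \<mu>"
  shows "convergent_mat A"
proof -
  have \<mu>: "0 \<le> \<mu>" "\<mu> < 1" using convergence_rate_nonneg_less_1[OF assms] by auto
  obtain L M where L: "L \<in> carrier_mat (dim_row A) (dim_col A)"
    and bound: "\<forall>\<^sub>F k in sequentially. op_norm (A ^\<^sub>m k - L) \<le> M * \<mu> ^ k"
    by (rule convergence_rate_eventually[OF assms])
  have "(\<lambda>k. M * \<mu> ^ k) \<longlonglongrightarrow> M * 0"
    using \<mu> by (intro tendsto_intros LIMSEQ_power_zero) simp
  then have lim: "(\<lambda>k. M * \<mu> ^ k) \<longlonglongrightarrow> 0" by simp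
  have nonneg: "\<forall>\<^sub>F k in sequentially. 0 \<le> op_norm (A ^\<^sub>m k - L)"
    by (simp add: op_norm_nonneg)
  have "(\<lambda>k. op_norm (A ^\<^sub>m k - L)) \<longlonglongrightarrow> 0"
    by (rule tendsto_sandwich[OF nonneg bound tendsto_const lim])
  then show ?thesis using L unfolding convergent_mat_def convergent_to_def by blast
qed

text \<open>
  No rate is below \<open>gamma A\<close>, since \<open>gamma A\<close> is \<open>0\<close> or the modulus of an eigenvalue other
  than \<open>1\<close>.
\<close>

lemma optimal_convergence_rate_gamma:
  assumes A: "A \<in> carrier_mat n n" and rate: "convergence_rate A (gamma A)"
  shows "optimal_convergence_rate A (gamma A)"
proof -
  have "gamma A \<le> \<nu>" if "convergence_rate A \<nu>" for \<nu>
  proof -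
    obtain l where l: "l = 0 \<or> l \<in> spectrum A" "l \<noteq> 1" "gamma A = cmod l"
      by (rule gamma_attained[OF A])
    have "cmod l \<le> \<nu>"
      using l(1)
    proof
      assume "l = 0"
      then show ?thesis using convergence_rate_nonneg_less_1[OF that] by simp
    next
      assume "l \<in> spectrum A"
      from this l(2) show ?thesis by (rule eigenvalue_le_convergence_rate[OF A that])
    qed
    then show ?thesis using l(3) by simp
  qed
  then have "Inf {\<nu>. convergence_rate A \<nu>} = gamma A"
    using rate by (intro cInf_eq_minimum) simp_all
  then show ?thesis using rate unfolding optimal_convergence_rate_def by simp
qed

theorem theorem2p15:
  fixes A :: "complex mat" and n :: nat
  assumes "n \<ge> 1" and "A \<in> carrier_mat n n"
    and "0 \<in> spectrum A \<Longrightarrow> gamma A = 0 \<Longrightarrow> semisimple A 0"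
  shows "convergent_mat A \<and> optimal_convergence_rate A (gamma A) \<longleftrightarrow>
    (spectral_radius A < 1 \<and>
       (\<forall>l \<in> spectrum A. cmod l = gamma A \<longrightarrow> semisimple A l)) \<or>
    (spectral_radius A = 1 \<and>
       {l \<in> spectrum A. cmod l = 1} = {1} \<and>
       semisimple A 1 \<and>
       (\<forall>l \<in> spectrum A. cmod l = gamma A \<longrightarrow> semisimple A l))"
    (is "_ \<longleftrightarrow> ?inside \<or> ?circle")
proof
  note A = assms(2)
  have n: "0 < n" using assms(1) by simp
  note radius = spectral_radius_mem_max[OF A n]
  assume "convergent_mat A \<and> optimal_convergence_rate A (gamma A)"
  then have rate: "convergence_rate A (gamma A)" unfolding optimal_convergence_rate_def by blast
  have g: "0 \<le> gamma A" "gamma A < 1" using convergence_rate_nonneg_less_1[OF rate] by auto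
  have lt: "cmod l < 1" if "l \<in> spectrum A" "l \<noteq> 1" for l
    using cmod_le_gamma[OF A that] g by simp
  have max: "\<forall>l \<in> spectrum A. cmod l = gamma A \<longrightarrow> semisimple A l"
  proof (intro ballI impI)
    fix l assume l: "l \<in> spectrum A" "cmod l = gamma A"
    show "semisimple A l"
    proof (cases "gamma A = 0")
      case True
      \<comment> \<open>The chain argument needs a positive rate; here \<open>l = 0\<close> and the hypothesis on \<open>0\<close> applies.\<close>
      with l assms(3) show ?thesis by simp
    next
      case False
      with l g show ?thesis by (intro semisimple_of_convergence_rate[OF A rate]) simp
    qed
  qed
  show "?inside \<or> ?circle"
  proof (cases "1 \<in> spectrum A")
    case True
    have "1 \<le> spectral_radius A" using True radius(2)[of 1] by force
    moreover have "spectral_radius A \<le> 1"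
      using radius(1) lt by (metis image_iff less_imp_le norm_one order_refl)
    moreover have "{l \<in> spectrum A. cmod l = 1} = {1}" using True lt by force
    ultimately show ?thesis
      using max semisimple_of_convergence_rate[OF A rate, of 1] by auto
  next
    case False
    then have "spectral_radius A < 1" using radius(1) lt by (metis image_iff)
    with max show ?thesis by blast
  qed
next
  note A = assms(2)
  have n: "0 < n" using assms(1) by simp
  have radius: "cmod l \<le> spectral_radius A" if "l \<in> spectrum A" for l
    using spectral_radius_mem_max(2)[OF A n] that by blast
  assume cases: "?inside \<or> ?circle"
  obtain l where l: "l = 0 \<or> l \<in> spectrum A" "l \<noteq> 1" "gamma A = cmod l"
    by (rule gamma_attained[OF A])
  have "gamma A < 1"
    using cases
  proof (elim disjE conjE)
    assume "spectral_radius A < 1"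
    with l radius show ?thesis by fastforce
  next
    assume "spectral_radius A = 1" "{l \<in> spectrum A. cmod l = 1} = {1}"
    with l radius[of l] show ?thesis by (cases "l = 0") (auto simp: less_le)
  qed
  moreover have "semisimple A 1" if "1 \<in> spectrum A"
    using cases radius[OF that] by auto
  ultimately have "convergence_rate A (gamma A)"
    using cases by (intro convergence_rate_gamma[OF A]) blast+
  then show "convergent_mat A \<and> optimal_convergence_rate A (gamma A)"
    using convergence_rate_imp_convergent optimal_convergence_rate_gamma[OF A] by blast
qed

end
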